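(* Let $E$ be a Banach lattice. If $T:E\to E$ is a u$\sigma$o-continuous power uo-demi Dunford–Pettis operator, then $T$ is uo-demi Dunford–Pettis.
   Context: All Banach lattices are real; "operator" means bounded linear map. A net $(x_\alpha)$ in a Banach lattice $E$ is uo-convergent (unbounded order convergent) to $x$, written $x_\alpha\xrightarrow{uo}x$, if $|x_\alpha-x|\wedge y$ converges in order to $0$ for every $y\in E^+$. An operator $T:E\to E$ on a Banach lattice $E$ is uo-demi Dunford–Pettis (unbounded order demi Dunford–Pettis) if for every weakly null sequence $(x_n)$ in $E$ such that $(x_n-T(x_n))$ is uo-convergent to $0$, one has $\|x_n\|\to0$. An operator $T:E\to E$ is power uo-demi Dunford–Pettis if $T^m$ is uo-demi Dunford–Pettis for some $m\in\mathbb{N}$. An operator $T:E\to E$ is u$\sigma$o-continuous (unbounded $\sigma$-order continuous) if for every sequence $(x_n)$ in $E$, $x_n\xrightarrow{uo}0$ implies $T(x_n)\xrightarrow{uo}0$. *)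

theory Defs
  imports "HOL-Analysis.Analysis" "HOL-Library.Lattice_Algebras"
begin

text \<open>The absolute value is \<open>\<bar>x\<bar> = sup x (- x)\<close>, by the axiom of
  \<^class>\<open>lattice_ab_group_add_abs\<close>.\<close>

class banach_lattice = banach + ordered_real_vector + lattice_ab_group_add_abs +
  assumes norm_mono_abs: "\<bar>x\<bar> \<le> \<bar>y\<bar> \<Longrightarrow> norm x \<le> norm y"

instance real :: banach_lattice
  by standard simp

text \<open>Order convergence of a net \<open>f\<close> to \<open>l\<close>: there is a net decreasing to \<open>0\<close>, in general with
  an index set of its own, each of whose terms eventually dominates \<open>\<bar>f i - l\<bar>\<close>. Indices of \<open>f\<close>
  enter only through the filter \<open>F\<close> of tails. The dominating net is represented
  by its range \<open>D\<close>, a downward directed set with infimum \<open>0\<close>, which is a decreasing net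
  indexed by itself. This avoids quantifying over index types; see
  \<open>order_convergesI_net\<close> below.\<close>

definition order_converges :: "('i \<Rightarrow> 'a::lattice_ab_group_add_abs) \<Rightarrow> 'a \<Rightarrow> 'i filter \<Rightarrow> bool" where
  "order_converges f l F \<longleftrightarrow>
     (\<exists>D. D \<noteq> {} \<and>
          (\<forall>a\<in>D. \<forall>b\<in>D. \<exists>c\<in>D. c \<le> a \<and> c \<le> b) \<and>
          (\<forall>d\<in>D. 0 \<le> d) \<and> (\<forall>z. (\<forall>d\<in>D. z \<le> d) \<longrightarrow> z \<le> 0) \<and>
          (\<forall>d\<in>D. \<forall>\<^sub>F i in F. \<bar>f i - l\<bar> \<le> d))"

lemma order_convergesI_net:
  fixes f :: "'i \<Rightarrow> 'a::lattice_ab_group_add_abs" and y :: "'j \<Rightarrow> 'a"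
    and J :: "'j set" and le :: "'j \<Rightarrow> 'j \<Rightarrow> bool"
  assumes "J \<noteq> {}"
    and directed: "\<And>j k. j \<in> J \<Longrightarrow> k \<in> J \<Longrightarrow> \<exists>m\<in>J. le j m \<and> le k m"
    and decreasing: "\<And>j k. j \<in> J \<Longrightarrow> k \<in> J \<Longrightarrow> le j k \<Longrightarrow> y k \<le> y j"
    and nonneg: "\<And>j. j \<in> J \<Longrightarrow> 0 \<le> y j"
    and greatest: "\<And>z. (\<And>j. j \<in> J \<Longrightarrow> z \<le> y j) \<Longrightarrow> z \<le> 0"
    and dominated: "\<And>j. j \<in> J \<Longrightarrow> \<forall>\<^sub>F i in F. \<bar>f i - l\<bar> \<le> y j"
  shows "order_converges f l F"
proof -
  have "\<exists>c\<in>y ` J. c \<le> a \<and> c \<le> b" if "a \<in> y ` J" "b \<in> y ` J" for a b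
    using that directed decreasing by (metis (no_types, lifting) image_iff)
  then show ?thesis
    unfolding order_converges_def using assms(1) nonneg greatest dominated
    by (intro exI[of _ "y ` J"]) auto
qed

definition uo_converges :: "('i \<Rightarrow> 'a::lattice_ab_group_add_abs) \<Rightarrow> 'a \<Rightarrow> 'i filter \<Rightarrow> bool" where
  "uo_converges f l F \<longleftrightarrow> (\<forall>y\<ge>0. order_converges (\<lambda>i. inf \<bar>f i - l\<bar> y) 0 F)"

definition weakly_null :: "(nat \<Rightarrow> 'a::real_normed_vector) \<Rightarrow> bool" where
  "weakly_null x \<longleftrightarrow> (\<forall>\<phi> :: 'a \<Rightarrow> real. bounded_linear \<phi> \<longrightarrow> (\<lambda>n. \<phi> (x n)) \<longlonglongrightarrow> 0)"

text \<open>The following are properties of a map \<open>T\<close>; boundedness and linearity of \<open>T\<close> are to be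
  assumed separately.\<close>

definition uo_demi_Dunford_Pettis :: "('a::banach_lattice \<Rightarrow> 'a) \<Rightarrow> bool" where
  "uo_demi_Dunford_Pettis T \<longleftrightarrow>
     (\<forall>x :: nat \<Rightarrow> 'a. weakly_null x \<longrightarrow> uo_converges (\<lambda>n. x n - T (x n)) 0 sequentially \<longrightarrow>
        (\<lambda>n. norm (x n)) \<longlonglongrightarrow> 0)"

text \<open>The exponent is positive. Admitting \<open>m = 0\<close> would give the same notion: if the identity
  is uo-demi Dunford--Pettis, then weakly null sequences are norm null, so every \<open>T\<close> is.\<close>

definition power_uo_demi_Dunford_Pettis :: "('a::banach_lattice \<Rightarrow> 'a) \<Rightarrow> bool" where
  "power_uo_demi_Dunford_Pettis T \<longleftrightarrow> (\<exists>m\<ge>1. uo_demi_Dunford_Pettis (T ^^ m))"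

definition u\<sigma>o_continuous :: "('a::banach_lattice \<Rightarrow> 'a) \<Rightarrow> bool" where
  "u\<sigma>o_continuous T \<longleftrightarrow>
     (\<forall>x :: nat \<Rightarrow> 'a. uo_converges x 0 sequentially \<longrightarrow>
        uo_converges (\<lambda>n. T (x n)) 0 sequentially)"

end

theory Submission
  imports Defs
begin

text \<open>The identity \<open>x - T\<^sup>m x = (\<Sum>k<m. T\<^sup>k (x - T x))\<close> shows that uo-convergence of
  \<open>x\<^sub>n - T x\<^sub>n\<close> to \<open>0\<close> passes to \<open>x\<^sub>n - T\<^sup>m x\<^sub>n\<close>, since uo-null sequences are closed under
  sums and under \<open>T\<close>.\<close>

text \<open>If \<open>A\<close> and \<open>B\<close> witness the two convergences, the sums
  \<open>a + b\<close> witness that of \<open>f + g\<close>. The two sets are unrelated, so the sums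
  are indexed by all pairs, ordered coordinatewise with smaller elements counting as later
  indices.\<close>

lemma order_converges_zero_add:
  fixes f g :: "'i \<Rightarrow> 'a::lattice_ab_group_add_abs"
  assumes "order_converges f 0 F" and "order_converges g 0 F"
  shows "order_converges (\<lambda>i. f i + g i) 0 F"
proof -
  obtain A where A: "A \<noteq> {}" "\<forall>a\<in>A. \<forall>b\<in>A. \<exists>c\<in>A. c \<le> a \<and> c \<le> b" "\<forall>d\<in>A. 0 \<le> d"
      "\<forall>z. (\<forall>d\<in>A. z \<le> d) \<longrightarrow> z \<le> 0" "\<forall>d\<in>A. \<forall>\<^sub>F i in F. \<bar>f i\<bar> \<le> d"
    using assms(1) unfolding order_converges_def diff_0_right by (elim exE conjE)
  obtain B where B: "B \<noteq> {}" "\<forall>a\<in>B. \<forall>b\<in>B. \<exists>c\<in>B. c \<le> a \<and> c \<le> b" "\<forall>d\<in>B. 0 \<le> d"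
      "\<forall>z. (\<forall>d\<in>B. z \<le> d) \<longrightarrow> z \<le> 0" "\<forall>d\<in>B. \<forall>\<^sub>F i in F. \<bar>g i\<bar> \<le> d"
    using assms(2) unfolding order_converges_def diff_0_right by (elim exE conjE)
  show ?thesis
  proof (rule order_convergesI_net[where J = "A \<times> B" and y = "\<lambda>(a, b). a + b"
        and le = "\<lambda>(a, b) (a', b'). a' \<le> a \<and> b' \<le> b"])
    show "A \<times> B \<noteq> {}"
      using A(1) B(1) by auto
    show "\<exists>m\<in>A \<times> B. (case j of (a, b) \<Rightarrow> \<lambda>(a', b'). a' \<le> a \<and> b' \<le> b) m
        \<and> (case k of (a, b) \<Rightarrow> \<lambda>(a', b'). a' \<le> a \<and> b' \<le> b) m"
      if "j \<in> A \<times> B" "k \<in> A \<times> B" for j k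
    proof -
      obtain a where "a \<in> A" "a \<le> fst j" "a \<le> fst k"
        using A(2) \<open>j \<in> A \<times> B\<close> \<open>k \<in> A \<times> B\<close> by (metis mem_Times_iff)
      moreover obtain b where "b \<in> B" "b \<le> snd j" "b \<le> snd k"
        using B(2) \<open>j \<in> A \<times> B\<close> \<open>k \<in> A \<times> B\<close> by (metis mem_Times_iff)
      ultimately show ?thesis
        by (intro bexI[of _ "(a, b)"]) (auto simp: case_prod_beta)
    qed
    show "z \<le> 0" if z: "\<And>j. j \<in> A \<times> B \<Longrightarrow> z \<le> (case j of (a, b) \<Rightarrow> a + b)" for z
    proof (rule B(4)[rule_format])
      \<comment> \<open>The infimum is taken one variable at a time: for fixed \<open>b\<close>,
        \<open>z - b\<close> is a lower bound of \<open>A\<close>, hence at most 0. So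
        \<open>z\<close> is a lower bound of \<open>B\<close>.\<close>
      fix b assume "b \<in> B"
      then have "\<forall>a\<in>A. z - b \<le> a"
        using z by (force simp: diff_le_eq)
      with A(4) have "z - b \<le> 0"
        by (elim allE[of _ "z - b"]) (rule mp)
      then show "z \<le> b"
        by simp
    qed
    show "\<forall>\<^sub>F i in F. \<bar>f i + g i - 0\<bar> \<le> (case j of (a, b) \<Rightarrow> a + b)"
      if j: "j \<in> A \<times> B" for j
    proof -
      have "\<forall>\<^sub>F i in F. \<bar>f i\<bar> \<le> fst j" "\<forall>\<^sub>F i in F. \<bar>g i\<bar> \<le> snd j"
        using A(5) B(5) j by auto
      then show ?thesis
      proof eventually_elim
        case (elim i)
        then have "\<bar>f i + g i\<bar> \<le> fst j + snd j"
          by (intro order_trans[OF abs_triangle_ineq] add_mono)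
        then show ?case
          by (simp add: case_prod_beta)
      qed
    qed
  qed (use A(3) B(3) in \<open>auto intro: add_mono\<close>)
qed

text \<open>The set that witnesses convergence of \<open>g\<close> serves for \<open>f\<close> as
  well.\<close>

lemma order_converges_zero_dominated:
  fixes f g :: "'i \<Rightarrow> 'a::lattice_ab_group_add_abs"
  assumes "order_converges g 0 F" and "\<And>i. \<bar>f i\<bar> \<le> \<bar>g i\<bar>"
  shows "order_converges f 0 F"
proof -
  obtain D where D: "D \<noteq> {}" "\<forall>a\<in>D. \<forall>b\<in>D. \<exists>c\<in>D. c \<le> a \<and> c \<le> b" "\<forall>d\<in>D. 0 \<le> d"
      "\<forall>z. (\<forall>d\<in>D. z \<le> d) \<longrightarrow> z \<le> 0" "\<forall>d\<in>D. \<forall>\<^sub>F i in F. \<bar>g i\<bar> \<le> d"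
    using assms(1) unfolding order_converges_def diff_0_right by (elim exE conjE)
  have "\<forall>d\<in>D. \<forall>\<^sub>F i in F. \<bar>f i\<bar> \<le> d"
  proof
    fix d assume "d \<in> D"
    with D(5) have "\<forall>\<^sub>F i in F. \<bar>g i\<bar> \<le> d" by (rule bspec)
    then show "\<forall>\<^sub>F i in F. \<bar>f i\<bar> \<le> d"
      by eventually_elim (rule order_trans[OF assms(2)])
  qed
  with D(1-4) show ?thesis
    unfolding order_converges_def diff_0_right by (intro exI[of _ D] conjI)
qed

lemma inf_add_le:
  fixes a b y :: "'a::lattice_ab_group_add"
  assumes "0 \<le> a" and "0 \<le> b" and "0 \<le> y"
  shows "inf (a + b) y \<le> inf a y + inf b y"
proof -
  \<comment> \<open>By distributivity the right-hand side is the infimum of \<open>a + b\<close>,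
    \<open>a + y\<close>, \<open>y + b\<close> and \<open>y + y\<close>. The last three lie above
    \<open>y\<close> by positivity.\<close>
  have "inf (a + b) y \<le> a + y" "inf (a + b) y \<le> y + b" "inf (a + b) y \<le> y + y"
    using assms by (auto intro: le_infI2 add_increasing add_increasing2)
  then show ?thesis
    by (simp add: add_inf_distrib_left add_inf_distrib_right)
qed

lemma uo_converges_zero_const: "uo_converges (\<lambda>_. 0) 0 F"
  unfolding uo_converges_def order_converges_def
  by (intro allI impI exI[of _ "{0}"]) (auto simp: inf_absorb1)

text \<open>For fixed \<open>y\<close>, truncation by \<open>y\<close> is subadditive on positive
  elements, which reduces the claim to order convergence of a sum of two truncations.\<close>

lemma uo_converges_zero_add:
  fixes f g :: "'i \<Rightarrow> 'a::lattice_ab_group_add_abs"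
  assumes "uo_converges f 0 F" and "uo_converges g 0 F"
  shows "uo_converges (\<lambda>i. f i + g i) 0 F"
  unfolding uo_converges_def
proof (intro allI impI)
  fix y :: 'a assume y: "0 \<le> y"
  have "order_converges (\<lambda>i. inf \<bar>f i\<bar> y + inf \<bar>g i\<bar> y) 0 F"
    using assms y unfolding uo_converges_def by (auto intro: order_converges_zero_add)
  moreover have "\<bar>inf \<bar>f i + g i\<bar> y\<bar> \<le> \<bar>inf \<bar>f i\<bar> y + inf \<bar>g i\<bar> y\<bar>" for i
  proof -
    have "inf \<bar>f i + g i\<bar> y \<le> inf (\<bar>f i\<bar> + \<bar>g i\<bar>) y"
      by (intro inf_mono abs_triangle_ineq order_refl)
    also have "\<dots> \<le> inf \<bar>f i\<bar> y + inf \<bar>g i\<bar> y"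
      using y by (intro inf_add_le) auto
    finally show ?thesis
      using y by (simp add: abs_of_nonneg)
  qed
  ultimately have "order_converges (\<lambda>i. inf \<bar>f i + g i\<bar> y) 0 F"
    by (rule order_converges_zero_dominated)
  then show "order_converges (\<lambda>i. inf \<bar>f i + g i - 0\<bar> y) 0 F"
    by simp
qed

lemma uo_converges_diff_funpow:
  fixes T :: "'a::banach_lattice \<Rightarrow> 'a"
  assumes "linear T" and "u\<sigma>o_continuous T"
    and "uo_converges (\<lambda>n. x n - T (x n)) 0 sequentially"
  shows "uo_converges (\<lambda>n. x n - (T ^^ m) (x n)) 0 sequentially"
proof (induction m)
  case 0
  show ?case
    by (simp add: uo_converges_zero_const)
next
  case (Suc m)
  then have "uo_converges (\<lambda>n. T (x n - (T ^^ m) (x n))) 0 sequentially"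
    using assms(2) unfolding u\<sigma>o_continuous_def by blast
  \<comment> \<open>One step of the telescoping:
    \<open>x - T ((T ^^ m) x) = (x - T x) + T (x - (T ^^ m) x)\<close>. With \<open>T\<close>
    outermost in the last summand, its continuity applies directly to the induction
    hypothesis.\<close>
  from uo_converges_zero_add[OF assms(3) this] show ?case
    by (simp add: linear_diff[OF assms(1)])
qed

theorem proposition5p2:
  fixes T :: "'a::banach_lattice \<Rightarrow> 'a"
  assumes "bounded_linear T"
    and "u\<sigma>o_continuous T"
    and "power_uo_demi_Dunford_Pettis T"
  shows "uo_demi_Dunford_Pettis T"
proof -
  obtain m where "uo_demi_Dunford_Pettis (T ^^ m)"
    using assms(3) unfolding power_uo_demi_Dunford_Pettis_def by blast
  \<comment> \<open>Weak nullity and the norm limit concern the sequence alone, so only the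
    uo-hypothesis has to be carried from \<open>T\<close> to \<open>T ^^ m\<close>.\<close>
  then show ?thesis
    using uo_converges_diff_funpow[OF bounded_linear.linear[OF assms(1)] assms(2)]
    unfolding uo_demi_Dunford_Pettis_def by blast
qed

end
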